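(* Let $X_i=\theta_i+\varepsilon_i\in\mathbb{R}^d$, $i\ge1$, where $\{\theta_i\}_{i\ge1}\subset\mathbb{R}^d$ is a fixed sequence and $\{\varepsilon_i\}_{i\ge1}$ are i.i.d. $\mathcal{N}(0,\Sigma)$. If $\Sigma$ is positive definite, the following holds with probability one: for all $g\in\mathbb{N}$ there exists $n_g\in\mathbb{N}$ such that for all $n\ge n_g$, $\langle\,\mathrm{I}_g(X_1,\dots,X_n)\,\rangle=\{0\}$ and $\mathcal{V}(\mathrm{I}_g(X_1,\dots,X_n))=\mathbb{R}^d$.
   Context: $\mathbb{N}=\{1,2,\dots\}$. For points $y_1,\dots,y_n\in\mathbb{R}^d$, $\mathrm{I}_g(y_1,\dots,y_n)=\{P\in\mathbb{R}[x_1,\dots,x_d]:\deg P\le g,\ P(y_j)=0\text{ for }j=1,\dots,n\}$. For a set $S$ of real polynomials, $\langle S\rangle$ is the ideal of $\mathbb{R}[x_1,\dots,x_d]$ generated by $S$ and $\mathcal{V}(S)\subset\mathbb{R}^d$ is the set of common real zeros of the elements of $S$. *)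

theory Defs
  imports "HOL-Probability.Probability" "HOL-Library.Poly_Mapping"
begin

text \<open>
  The polynomial ring over the reals in the variables indexed by the finite type \<open>'d\<close>:
  a polynomial maps each exponent vector to its coefficient, with finite support.
  The ring operations are those of \<^type>\<open>poly_mapping\<close> (convolution product).
\<close>

type_synonym 'd rpoly = "('d \<Rightarrow>\<^sub>0 nat) \<Rightarrow>\<^sub>0 real"

definition poly_eval :: "('d::finite) rpoly \<Rightarrow> real ^ 'd \<Rightarrow> real" where
  "poly_eval P x =
     (\<Sum>m\<in>Poly_Mapping.keys P. Poly_Mapping.lookup P m * (\<Prod>i\<in>UNIV. (x $ i) ^ Poly_Mapping.lookup m i))"

definition monomial_degree :: "(('d::finite) \<Rightarrow>\<^sub>0 nat) \<Rightarrow> nat" where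
  "monomial_degree m = (\<Sum>i\<in>UNIV. Poly_Mapping.lookup m i)"

text \<open>The total degree. The zero polynomial gets degree \<open>0\<close>; as only bounds
  \<open>deg P \<le> g\<close> with \<open>g\<close> a natural number are used, the convention
  \<open>deg 0 = - \<infinity>\<close> would make no difference.\<close>

definition poly_degree :: "('d::finite) rpoly \<Rightarrow> nat" where
  "poly_degree P = Max (insert 0 (monomial_degree ` Poly_Mapping.keys P))"

text \<open>The points are \<open>y 1, \<dots>, y n\<close>; the value \<open>y 0\<close> is never used.\<close>

definition vanishing_polys :: "nat \<Rightarrow> nat \<Rightarrow> (nat \<Rightarrow> real ^ ('d::finite)) \<Rightarrow> 'd rpoly set" where
  "vanishing_polys g n y = {P. poly_degree P \<le> g \<and> (\<forall>j\<in>{1..n}. poly_eval P (y j) = 0)}"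

text \<open>A commutative ring is a module over itself, and its submodules are its ideals.\<close>

lemma module_times: "module ((*) :: 'a::comm_ring_1 \<Rightarrow> 'a \<Rightarrow> 'a)"
  by unfold_locales (simp_all add: algebra_simps)

definition ideal_generated :: "('a::comm_ring_1) set \<Rightarrow> 'a set" where
  "ideal_generated S = module.span (*) S"

definition zero_locus :: "('d::finite) rpoly set \<Rightarrow> (real ^ 'd) set" where
  "zero_locus S = {x. \<forall>P\<in>S. poly_eval P x = 0}"

definition positive_definite :: "real ^ 'd ^ ('d::finite) \<Rightarrow> bool" where
  "positive_definite A \<longleftrightarrow> transpose A = A \<and> (\<forall>x. x \<noteq> 0 \<longrightarrow> x \<bullet> (A *v x) > 0)"

text \<open>The Lebesgue density of the normal law with mean \<open>\<mu>\<close> and positive definite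
  covariance matrix \<open>A\<close>.\<close>

definition multivariate_normal_density ::
  "real ^ 'd \<Rightarrow> real ^ 'd ^ ('d::finite) \<Rightarrow> real ^ 'd \<Rightarrow> real" where
  "multivariate_normal_density \<mu> A x =
     exp (- ((x - \<mu>) \<bullet> (matrix_inv A *v (x - \<mu>))) / 2) / sqrt ((2 * pi) ^ CARD('d) * det A)"

end

theory Submission
  imports Defs "Jordan_Normal_Form.Determinant"
begin

text \<open>
  Fix \<open>g\<close> and let \<open>m\<^sub>0, \<dots>, m\<^bsub>N-1\<^esub>\<close> be the monomials of degree at most \<open>g\<close>. A polynomial of
  degree at most \<open>g\<close> that vanishes at \<open>X\<^sub>1, \<dots>, X\<^sub>N\<close> has its coefficient vector in the kernel of
  the matrix \<open>(m\<^sub>j(X\<^bsub>i+1\<^esub>))\<close> with \<open>i, j < N\<close>. Almost surely this matrix is invertible, so that for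
  every \<open>n \<ge> N\<close> the zero polynomial is the only member of
  \<open>vanishing_polys g n\<close>; both claims of the theorem then concern the set \<open>{0}\<close>. As there are
  countably many \<open>g\<close>, one null set serves all of them.

  Invertibility is shown by adding one point at a time (\<open>AE_PiM_collocation_det_nonzero\<close>).
  Expanding the determinant of size \<open>k + 1\<close> along its last row displays it as a polynomial
  \<open>\<Sum>j\<le>k. C\<^sub>j m\<^sub>j\<close> evaluated at the newest point. The coefficients \<open>C\<^sub>j\<close> depend only on the earlier
  points, and \<open>C\<^sub>k\<close> is the determinant of size \<open>k\<close>, almost surely nonzero by induction. The newest
  point is independent of the earlier ones, so it remains to know that its law gives no mass to
  the zero set of a nonzero polynomial. This holds because the law is absolutely continuous and
  such zero sets are Lebesgue null (\<open>AE_lborel_monomial_sum_nonzero\<close>). Shifting a point by the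
  deterministic \<open>\<theta>\<^sub>i\<close> preserves absolute continuity since Lebesgue measure is translation
  invariant.
\<close>

section \<open>Zero sets of polynomials are Lebesgue null\<close>

text \<open>
  Fubini's theorem for null sets. It carries the inductions on the number of coordinates and on the
  number of points: the exceptional set of values of the new coordinate may depend on the old ones.
\<close>

lemma (in product_sigma_finite) AE_PiM_insertI:
  assumes "finite I" "i \<notin> I"
    and P [measurable]: "Measurable.pred (PiM (insert i I) M) P"
    and ae: "AE x in PiM I M. AE y in M i. P (x(i := y))"
  shows "AE x in PiM (insert i I) M. P x"
proof -
  let ?S = "PiM (insert i I) M"
  let ?f = "indicator {x\<in>space ?S. \<not> P x} :: _ \<Rightarrow> ennreal"
  have "integral\<^sup>N ?S ?f = (\<integral>\<^sup>+ x. (\<integral>\<^sup>+ y. ?f (x(i := y)) \<partial>M i) \<partial>PiM I M)"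
    by (rule product_nn_integral_insert) (use assms in auto)
  also have "\<dots> = (\<integral>\<^sup>+ x. 0 \<partial>PiM I M)"
  proof (rule nn_integral_cong_AE)
    from ae show "AE x in PiM I M. (\<integral>\<^sup>+ y. ?f (x(i := y)) \<partial>M i) = 0"
    proof (rule AE_mp, intro AE_I2 impI)
      fix x assume "AE y in M i. P (x(i := y))"
      then have "(\<integral>\<^sup>+ y. ?f (x(i := y)) \<partial>M i) = (\<integral>\<^sup>+ y. 0 \<partial>M i)"
        by (intro nn_integral_cong_AE) (auto split: split_indicator)
      then show "(\<integral>\<^sup>+ y. ?f (x(i := y)) \<partial>M i) = 0" by simp
    qed
  qed
  finally have "integral\<^sup>N ?S ?f = 0" by simp
  then have "AE x in ?S. ?f x = 0"
    by (subst (asm) nn_integral_0_iff_AE) auto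
  then show ?thesis by (auto elim!: AE_mp intro!: AE_I2 split: split_indicator_asm)
qed

text \<open>
  Induction on the set of coordinates. For a new coordinate \<open>i\<close>, sorting the monomials by their
  exponent of \<open>i\<close> gives a univariate polynomial in that coordinate, with coefficients \<open>a x k\<close> that
  are polynomials in the old coordinates. The coefficient that receives the monomial \<open>j0\<close> is
  almost everywhere nonzero by induction, and then only finitely many values of the new coordinate
  are roots. Exponents are compared on \<open>I\<close> alone, because that is what survives
  dropping a coordinate: monomials with the same exponent of \<open>i\<close> that agree on \<open>I\<close> agree on
  \<open>insert i I\<close>.
\<close>

lemma AE_PiM_lborel_monomial_sum_nonzero:
  fixes c :: "'j \<Rightarrow> real" and e :: "'j \<Rightarrow> 'b \<Rightarrow> nat"
  assumes "finite I" "finite J" "j0 \<in> J" "c j0 \<noteq> 0"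
    and "\<And>j j'. j \<in> J \<Longrightarrow> j' \<in> J \<Longrightarrow> (\<forall>b\<in>I. e j b = e j' b) \<Longrightarrow> j = j'"
  shows "AE x in PiM I (\<lambda>_. lborel :: real measure). (\<Sum>j\<in>J. c j * (\<Prod>b\<in>I. x b ^ e j b)) \<noteq> 0"
  using assms
proof (induction I arbitrary: J rule: finite_induct)
  case empty
  then have "J = {j0}" by auto
  with empty show ?case by simp
next
  case (insert i I)
  interpret product_sigma_finite "\<lambda>_. lborel :: real measure" ..
  define n where "n = Max ((\<lambda>j. e j i) ` J)"
  have n: "e j i \<le> n" if "j \<in> J" for j
    using that insert.prems by (auto simp: n_def)
  define a where "a x k = (\<Sum>j | j \<in> J \<and> e j i = k. c j * (\<Prod>b\<in>I. x b ^ e j b))" for x k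
  have eq: "(\<Sum>j\<in>J. c j * (\<Prod>b\<in>insert i I. (x(i := t)) b ^ e j b)) = (\<Sum>k\<le>n. a x k * t ^ k)"
    for x t
  proof -
    have "(\<Sum>j\<in>J. c j * (\<Prod>b\<in>insert i I. (x(i := t)) b ^ e j b))
        = (\<Sum>j\<in>J. c j * (\<Prod>b\<in>I. x b ^ e j b) * t ^ e j i)"
    proof (rule sum.cong[OF refl])
      fix j
      have "(\<Prod>b\<in>I. (x(i := t)) b ^ e j b) = (\<Prod>b\<in>I. x b ^ e j b)"
        using insert.hyps by (intro prod.cong) auto
      then show "c j * (\<Prod>b\<in>insert i I. (x(i := t)) b ^ e j b)
          = c j * (\<Prod>b\<in>I. x b ^ e j b) * t ^ e j i"
        using insert.hyps by simp
    qed
    also have "\<dots> = (\<Sum>k\<le>n. \<Sum>j | j \<in> J \<and> e j i = k. c j * (\<Prod>b\<in>I. x b ^ e j b) * t ^ e j i)"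
      by (rule sum.group[symmetric]) (use insert.prems n in auto)
    also have "\<dots> = (\<Sum>k\<le>n. a x k * t ^ k)"
      by (simp add: a_def sum_distrib_right)
    finally show ?thesis .
  qed
  have "AE x in PiM I (\<lambda>_. lborel). a x (e j0 i) \<noteq> 0"
    unfolding a_def
  proof (rule insert.IH)
    fix j j' assume "j \<in> {j \<in> J. e j i = e j0 i}" "j' \<in> {j \<in> J. e j i = e j0 i}"
      "\<forall>b\<in>I. e j b = e j' b"
    then show "j = j'" using insert.prems(4)[of j j'] by auto
  qed (use insert.prems in auto)
  then have "AE x in PiM I (\<lambda>_. lborel). AE t in lborel. (\<Sum>k\<le>n. a x k * t ^ k) \<noteq> 0"
  proof (rule eventually_mono)
    fix x assume "a x (e j0 i) \<noteq> 0"
    then have "finite {t. (\<Sum>k\<le>n. a x k * t ^ k) = 0}"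
      using n[OF \<open>j0 \<in> J\<close>] by (subst polyfun_finite_roots) auto
    from finite_imp_null_set_lborel[OF this]
    show "AE t in lborel. (\<Sum>k\<le>n. a x k * t ^ k) \<noteq> 0"
      by (auto dest: AE_not_in)
  qed
  then show ?case
    by (intro AE_PiM_insertI) (use insert.hyps in \<open>simp_all only: eq, simp_all\<close>)
qed

text \<open>
  The preceding lemma moved from the product measure to \<open>real ^ 'd\<close>, by reading the standard
  basis vectors as the index set of the product.
\<close>

lemma AE_lborel_monomial_sum_nonzero:
  fixes c :: "'j \<Rightarrow> real" and e :: "'j \<Rightarrow> 'd::finite \<Rightarrow> nat"
  assumes "finite J" "j0 \<in> J" "c j0 \<noteq> 0" "inj_on e J"
  shows "AE x in (lborel :: (real ^ 'd) measure). (\<Sum>j\<in>J. c j * (\<Prod>i\<in>UNIV. vec_nth x i ^ e j i)) \<noteq> 0"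
proof -
  define u :: "'d \<Rightarrow> real ^ 'd" where "u i = axis i 1" for i
  have B: "Basis = range u"
    by (auto simp: u_def Basis_vec_def)
  have u: "inj u" by (auto simp: u_def inj_def axis_eq_axis)
  define e' where "e' j b = e j (inv_into UNIV u b)" for j b
  let ?T = "\<lambda>f::real ^ 'd \<Rightarrow> real. \<Sum>b\<in>Basis. f b *\<^sub>R b"
  have "AE f in PiM Basis (\<lambda>_. lborel). (\<Sum>j\<in>J. c j * (\<Prod>b\<in>Basis. f b ^ e' j b)) \<noteq> 0"
  proof (rule AE_PiM_lborel_monomial_sum_nonzero)
    fix j j' assume j: "j \<in> J" "j' \<in> J" and "\<forall>b\<in>Basis. e' j b = e' j' b"
    then have "e j = e j'" by (auto simp: B e'_def u fun_eq_iff)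
    with j show "j = j'" using assms by (auto dest: inj_onD)
  qed (use assms in auto)
  also have "(\<lambda>f. (\<Sum>j\<in>J. c j * (\<Prod>b\<in>Basis. f b ^ e' j b)) \<noteq> 0)
      = (\<lambda>f. (\<Sum>j\<in>J. c j * (\<Prod>i\<in>UNIV. vec_nth (?T f) i ^ e j i)) \<noteq> 0)"
  proof -
    have "(\<Prod>b\<in>Basis. f b ^ e' j b) = (\<Prod>i\<in>UNIV. vec_nth (?T f) i ^ e j i)" for f j
    proof -
      have "vec_nth (?T f) i = f (u i)" for i
      proof -
        have "vec_nth (?T f) i = ?T f \<bullet> u i" by (simp add: u_def inner_axis)
        also have "\<dots> = f (u i)" by (rule inner_sum_left_Basis) (simp add: B)
        finally show ?thesis .
      qed
      then show ?thesis unfolding B by (simp add: prod.reindex[OF u] e'_def u)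
    qed
    then show ?thesis by simp
  qed
  finally show ?thesis
    by (subst lborel_eq, subst AE_distr_iff) auto
qed

section \<open>Determinants of evaluation matrices at independent points\<close>

lemma borel_measurable_det:
  fixes a :: "'a \<Rightarrow> nat \<Rightarrow> nat \<Rightarrow> real"
  assumes "\<And>i j. i < k \<Longrightarrow> j < k \<Longrightarrow> (\<lambda>x. a x i j) \<in> borel_measurable N"
  shows "(\<lambda>x. Determinant.det (mat k k (\<lambda>(i, j). a x i j))) \<in> borel_measurable N"
proof -
  have "Determinant.det (mat k k (\<lambda>(i, j). a x i j))
      = (\<Sum>p | p permutes {0..<k}. signof p * (\<Prod>i=0..<k. a x i (p i)))" for x
    unfolding Determinant.det_def
    by (auto intro!: sum.cong prod.cong simp: permutes_in_image)
  moreover have "(\<lambda>x. \<Sum>p | p permutes {0..<k}. signof p * (\<Prod>i=0..<k. a x i (p i)))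
      \<in> borel_measurable N"
    using assms
    by (intro borel_measurable_sum borel_measurable_times borel_measurable_prod
        borel_measurable_const) (auto simp: permutes_in_image)
  ultimately show ?thesis by simp
qed

text \<open>
  The hypothesis \<open>indep\<close> is linear independence of \<open>f 0, \<dots>, f (N - 1)\<close> modulo null sets, phrased
  for combinations whose last coefficient is nonzero. In this form it applies directly to the
  expansion along the last row, where the last coefficient is the smaller determinant.
\<close>

lemma AE_PiM_collocation_det_nonzero:
  fixes f :: "nat \<Rightarrow> 'a \<Rightarrow> real" and \<mu> :: "nat \<Rightarrow> 'a measure"
  assumes sf: "\<And>i. sigma_finite_measure (\<mu> i)"
    and meas: "\<And>i j. f j \<in> borel_measurable (\<mu> i)"
    and indep: "\<And>i k c. k < N \<Longrightarrow> c k \<noteq> 0 \<Longrightarrow> AE x in \<mu> i. (\<Sum>j\<le>k. c j * f j x) \<noteq> 0"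
    and "k \<le> N"
  shows "AE y in PiM {1..k} \<mu>. Determinant.det (mat k k (\<lambda>(i, j). f j (y (Suc i)))) \<noteq> 0"
  using \<open>k \<le> N\<close>
proof (induction k)
  case 0
  then show ?case by simp
next
  case (Suc k)
  interpret product_sigma_finite \<mu> by (rule product_sigma_finite.intro) (rule sf)
  let ?A = "\<lambda>k y. mat k k (\<lambda>(i, j). f j (y (Suc i)))"
  define C where "C y j = cofactor (?A (Suc k) y) k j" for y j
  \<comment> \<open>The cofactors of the last row ignore that row, hence the newest point.\<close>
  have C: "C (y(Suc k := z)) j = C y j" for y z j
    unfolding C_def cofactor_def mat_delete_def
    by (intro arg_cong2[where f = "(*)"] arg_cong[where f = Determinant.det] refl eq_matI) auto
  have C_last: "C y k = Determinant.det (?A k y)" for y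
    unfolding C_def cofactor_def mat_delete_def
    by (simp, intro arg_cong[where f = Determinant.det] eq_matI) auto
  have expand: "Determinant.det (?A (Suc k) (y(Suc k := z))) = (\<Sum>j\<le>k. C y j * f j z)" for y z
  proof -
    have "Determinant.det (?A (Suc k) (y(Suc k := z)))
        = (\<Sum>j<Suc k. ?A (Suc k) (y(Suc k := z)) $$ (k, j) * C (y(Suc k := z)) j)"
      unfolding C_def by (rule laplace_expansion_row) auto
    also have "\<dots> = (\<Sum>j\<le>k. C y j * f j z)"
      unfolding C by (rule sum.cong) auto
    finally show ?thesis .
  qed
  have "AE y in PiM {1..k} \<mu>. AE z in \<mu> (Suc k). (\<Sum>j\<le>k. C y j * f j z) \<noteq> 0"
  proof -
    have "AE y in PiM {1..k} \<mu>. C y k \<noteq> 0"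
      using Suc by (simp add: C_last)
    then show ?thesis
      by (rule AE_mp) (use Suc.prems indep in auto)
  qed
  then have "AE y in PiM (insert (Suc k) {1..k}) \<mu>. Determinant.det (?A (Suc k) y) \<noteq> 0"
  proof (intro AE_PiM_insertI)
    have "(\<lambda>y. Determinant.det (?A (Suc k) y)) \<in> borel_measurable (PiM (insert (Suc k) {1..k}) \<mu>)"
    proof (rule borel_measurable_det)
      fix i j assume "i < Suc k"
      then have i: "Suc i \<in> insert (Suc k) {1..k}" by auto
      show "(\<lambda>y. f j (y (Suc i))) \<in> borel_measurable (PiM (insert (Suc k) {1..k}) \<mu>)"
        by (rule measurable_compose[OF measurable_component_singleton[OF i] meas])
    qed
    then show "Measurable.pred (PiM (insert (Suc k) {1..k}) \<mu>)
        (\<lambda>y. Determinant.det (?A (Suc k) y) \<noteq> 0)"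
      by measurable
  qed (simp_all only: expand, simp_all)
  moreover have "insert (Suc k) {1..k} = {1..Suc k}" by auto
  ultimately show ?case by (simp only:)
qed

lemma det_nonzero_imp_trivial_kernel:
  fixes a :: "nat \<Rightarrow> nat \<Rightarrow> 'a::idom"
  assumes "Determinant.det (mat N N (\<lambda>(i, j). a i j)) \<noteq> 0"
    and "\<And>i. i < N \<Longrightarrow> (\<Sum>j<N. a i j * c j) = 0" and "j < N"
  shows "c j = 0"
proof (rule ccontr)
  assume "c j \<noteq> 0"
  let ?A = "mat N N (\<lambda>(i, j). a i j)"
  have "?A *\<^sub>v vec N c = 0\<^sub>v N"
    by (rule eq_vecI) (use assms(2) in \<open>auto simp: scalar_prod_def atLeast0LessThan\<close>)
  moreover have "vec N c \<noteq> 0\<^sub>v N"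
    using \<open>c j \<noteq> 0\<close> \<open>j < N\<close> by (metis index_vec index_zero_vec(1))
  ultimately have "Determinant.det ?A = 0"
    using det_0_iff_vec_prod_zero[of ?A N] by (auto intro!: exI[of _ "vec N c"])
  with assms(1) show False by simp
qed

section \<open>Polynomials of bounded degree vanishing at random points\<close>

lemma finite_monomials_bounded_degree:
  "finite {m :: 'd::finite \<Rightarrow>\<^sub>0 nat. monomial_degree m \<le> g}"
proof (rule finite_imageD)
  have "Poly_Mapping.lookup m i \<le> g" if "monomial_degree m \<le> g" for m :: "'d \<Rightarrow>\<^sub>0 nat" and i
    using that member_le_sum[of i UNIV "Poly_Mapping.lookup m"] by (simp add: monomial_degree_def)
  then have "Poly_Mapping.lookup ` {m :: 'd \<Rightarrow>\<^sub>0 nat. monomial_degree m \<le> g} \<subseteq> Pi\<^sub>E UNIV (\<lambda>_. {..g})"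
    by auto
  then show "finite (Poly_Mapping.lookup ` {m :: 'd \<Rightarrow>\<^sub>0 nat. monomial_degree m \<le> g})"
    by (rule finite_subset) (simp add: finite_PiE)
qed (simp add: inj_on_def lookup_inject)

lemma keys_bounded_degree:
  assumes "poly_degree P \<le> g"
  shows "Poly_Mapping.keys P \<subseteq> {m. monomial_degree m \<le> g}"
  using assms by (auto simp: poly_degree_def)

lemma ideal_generated_zero: "ideal_generated {0} = {0}"
proof -
  interpret Modules.module "(*) :: 'a::comm_ring_1 \<Rightarrow> 'a \<Rightarrow> 'a" by (rule module_times)
  show ?thesis unfolding ideal_generated_def by (simp add: span_insert_0)
qed

lemma zero_locus_zero: "zero_locus {0} = UNIV"
  by (simp add: zero_locus_def poly_eval_def)

text \<open>
  One can take \<open>N\<close> to be the number of monomials of degree at most \<open>g\<close>: by then the evaluation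
  matrix is square and almost surely invertible. Further points only shrink the
  space of vanishing polynomials.
\<close>

lemma AE_vanishing_polys_trivial:
  fixes M :: "'a measure" and X :: "nat \<Rightarrow> 'a \<Rightarrow> real ^ ('d::finite)"
  assumes "prob_space M"
    and indep: "prob_space.indep_vars M (\<lambda>_. borel) X {1..}"
    and ac: "\<And>i. i \<ge> 1 \<Longrightarrow> absolutely_continuous lborel (distr M borel (X i))"
  shows "AE \<omega> in M. \<exists>N\<ge>1. \<forall>n\<ge>N. vanishing_polys g n (\<lambda>i. X i \<omega>) = {0}"
proof -
  interpret prob_space M by fact
  define K where "K = {m :: 'd \<Rightarrow>\<^sub>0 nat. monomial_degree m \<le> g}"
  define N where "N = card K"
  have K: "finite K" unfolding K_def by (rule finite_monomials_bounded_degree)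
  have "0 \<in> K" by (simp add: K_def monomial_degree_def)
  with K have N: "N \<ge> 1" by (auto simp: N_def Suc_le_eq card_gt_0_iff)
  obtain h where h: "bij_betw h {..<N} K"
    using ex_bij_betw_nat_finite[OF K] by (auto simp: N_def atLeast0LessThan)
  define f where "f j x = (\<Prod>i\<in>UNIV. vec_nth x i ^ Poly_Mapping.lookup (h j) i)" for j and x :: "real ^ 'd"
  \<comment> \<open>The sample starts at index 1; Lebesgue measure at index 0 makes all members of the family
    sigma-finite and absolutely continuous.\<close>
  define \<mu> where "\<mu> i = (if i \<ge> 1 then distr M borel (X i) else lborel)" for i
  have rv: "X i \<in> measurable M borel" if "i \<ge> 1" for i
    using indep that by (auto simp: indep_vars_def)
  have sets_\<mu>: "sets (\<mu> i) = sets borel" for i by (simp add: \<mu>_def)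
  have f: "f j \<in> borel_measurable borel" for j
    unfolding f_def by measurable
  have "AE y in PiM {1..N} \<mu>. Determinant.det (mat N N (\<lambda>(i, j). f j (y (Suc i)))) \<noteq> 0"
  proof (rule AE_PiM_collocation_det_nonzero)
    show "sigma_finite_measure (\<mu> i)" for i
      by (auto simp: \<mu>_def rv intro!: prob_space_imp_sigma_finite prob_space_distr lborel.sigma_finite_measure_axioms)
    show "f j \<in> borel_measurable (\<mu> i)" for i j
      using f measurable_cong_sets[OF sets_\<mu> refl] by blast
  next
    fix i k and c :: "nat \<Rightarrow> real" assume k: "k < N" "c k \<noteq> 0"
    have "AE x in lborel. (\<Sum>j\<in>{..k}. c j * f j x) \<noteq> 0"
      unfolding f_def
    proof (rule AE_lborel_monomial_sum_nonzero)
      show "inj_on (\<lambda>j. Poly_Mapping.lookup (h j)) {..k}"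
        using k bij_betw_imp_inj_on[OF h] by (auto simp: inj_on_def lookup_inject)
    qed (use k in auto)
    moreover have "absolutely_continuous lborel (\<mu> i)"
      using ac by (auto simp: \<mu>_def absolutely_continuous_def)
    ultimately show "AE x in \<mu> i. (\<Sum>j\<le>k. c j * f j x) \<noteq> 0"
      by (intro absolutely_continuous_AE[of "\<mu> i" lborel]) (simp_all add: sets_\<mu>)
  qed simp
  also have "PiM {1..N} \<mu> = PiM {1..N} (\<lambda>i. distr M borel (X i))"
    by (rule PiM_cong) (auto simp: \<mu>_def)
  also have "\<dots> = distr M (PiM {1..N} (\<lambda>_. borel)) (\<lambda>\<omega>. \<lambda>i\<in>{1..N}. X i \<omega>)"
    using N by (intro indep_vars_iff_distr_eq_PiM'[THEN iffD1, symmetric]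
        indep_vars_subset[OF indep] rv) auto
  finally have "AE \<omega> in M. Determinant.det (mat N N (\<lambda>(i, j). f j ((\<lambda>i\<in>{1..N}. X i \<omega>) (Suc i)))) \<noteq> 0"
    by (rule AE_distrD[rotated]) (auto intro!: measurable_restrict rv)
  then show ?thesis
  proof (rule AE_mp, intro AE_I2 impI)
    fix \<omega> assume "Determinant.det (mat N N (\<lambda>(i, j). f j ((\<lambda>i\<in>{1..N}. X i \<omega>) (Suc i)))) \<noteq> 0"
    also have "mat N N (\<lambda>(i, j). f j ((\<lambda>i\<in>{1..N}. X i \<omega>) (Suc i))) = mat N N (\<lambda>(i, j). f j (X (Suc i) \<omega>))"
      by (rule eq_matI) auto
    finally have det: "Determinant.det (mat N N (\<lambda>(i, j). f j (X (Suc i) \<omega>))) \<noteq> 0" .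
    have "vanishing_polys g n (\<lambda>i. X i \<omega>) = {0}" if "n \<ge> N" for n
    proof (rule antisym; rule subsetI)
      fix P assume P: "P \<in> vanishing_polys g n (\<lambda>i. X i \<omega>)"
      then have keys: "Poly_Mapping.keys P \<subseteq> K"
        using keys_bounded_degree by (auto simp: vanishing_polys_def K_def)
      have eval: "poly_eval P x = (\<Sum>j<N. f j x * Poly_Mapping.lookup P (h j))" for x
      proof -
        have "poly_eval P x = (\<Sum>m\<in>K. Poly_Mapping.lookup P m * (\<Prod>i\<in>UNIV. vec_nth x i ^ Poly_Mapping.lookup m i))"
          unfolding poly_eval_def
          by (rule sum.mono_neutral_left) (use K keys in \<open>auto simp: in_keys_iff\<close>)
        also have "\<dots> = (\<Sum>j<N. f j x * Poly_Mapping.lookup P (h j))"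
          by (subst sum.reindex_bij_betw[OF h, symmetric]) (simp add: f_def mult.commute)
        finally show ?thesis .
      qed
      have "Poly_Mapping.lookup P (h j) = 0" if "j < N" for j
      proof (rule det_nonzero_imp_trivial_kernel[OF det _ that])
        fix i assume "i < N"
        with \<open>n \<ge> N\<close> P have "poly_eval P (X (Suc i) \<omega>) = 0"
          by (auto simp: vanishing_polys_def)
        then show "(\<Sum>j<N. f j (X (Suc i) \<omega>) * Poly_Mapping.lookup P (h j)) = 0"
          by (simp add: eval)
      qed
      then have "Poly_Mapping.lookup P m = 0" if "m \<in> K" for m
        using that bij_betw_imp_surj_on[OF h] by auto
      with keys have "Poly_Mapping.lookup P m = 0" for m
        by (cases "m \<in> K") (auto simp: in_keys_iff)
      then have "P = 0" by (intro poly_mapping_eqI) simp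
      then show "P \<in> {0}" by simp
    qed (simp add: vanishing_polys_def poly_degree_def poly_eval_def)
    with N show "\<exists>N\<ge>1. \<forall>n\<ge>N. vanishing_polys g n (\<lambda>i. X i \<omega>) = {0}" by blast
  qed
qed

text \<open>
  If \<open>S\<close> is a Lebesgue null set, so is its translate by \<open>- c\<close>, and a variable with a density avoids
  that translate almost surely.
\<close>

lemma absolutely_continuous_distr_translate:
  fixes Y :: "'a \<Rightarrow> 'b::euclidean_space"
  assumes "distributed M lborel Y p"
  shows "absolutely_continuous lborel (distr M borel (\<lambda>\<omega>. c + Y \<omega>))"
  unfolding absolutely_continuous_def
proof
  fix S :: "'b set" assume S: "S \<in> null_sets lborel"
  then have [measurable]: "S \<in> sets borel" by auto
  have [measurable]: "Y \<in> borel_measurable M"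
    using distributed_measurable[OF assms] by simp
  have p [measurable]: "p \<in> borel_measurable lborel"
    using assms by (auto simp: distributed_def)
  from S have "AE x in distr lborel borel ((+) c). x \<notin> S"
    by (simp add: lborel_distr_plus AE_not_in)
  then have "AE x in lborel. c + x \<notin> S"
    by (rule AE_distrD[rotated]) simp
  then have "AE x in density lborel p. c + x \<notin> S"
    by (subst AE_density) auto
  also have "density lborel p = distr M lborel Y"
    using distributed_distr_eq_density[OF assms] by simp
  finally have "AE \<omega> in M. c + Y \<omega> \<notin> S"
    by (rule AE_distrD[rotated]) simp
  then have "AE x in distr M borel (\<lambda>\<omega>. c + Y \<omega>). x \<notin> S"
    by (subst AE_distr_iff) auto
  then show "S \<in> null_sets (distr M borel (\<lambda>\<omega>. c + Y \<omega>))"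
    by (subst (asm) AE_iff_null_sets[symmetric]) auto
qed

theorem corollary3p3:
  fixes M :: "'a measure"
    and \<theta> :: "nat \<Rightarrow> real ^ ('d::finite)"
    and \<epsilon> :: "nat \<Rightarrow> 'a \<Rightarrow> real ^ 'd"
    and X :: "nat \<Rightarrow> 'a \<Rightarrow> real ^ 'd"
    and A :: "real ^ 'd ^ 'd"
  assumes "prob_space M"
    and "positive_definite A"
    and "prob_space.indep_vars M (\<lambda>_. borel) \<epsilon> {1..}"
    and "\<And>i. i \<ge> 1 \<Longrightarrow> distributed M lborel (\<epsilon> i) (\<lambda>x. ennreal (multivariate_normal_density 0 A x))"
    and "\<And>i \<omega>. i \<ge> 1 \<Longrightarrow> \<omega> \<in> space M \<Longrightarrow> X i \<omega> = \<theta> i + \<epsilon> i \<omega>"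
  shows "AE \<omega> in M. \<forall>g\<ge>1. \<exists>n\<^sub>g\<ge>1. \<forall>n\<ge>n\<^sub>g.
           ideal_generated (vanishing_polys g n (\<lambda>i. X i \<omega>)) = {0} \<and>
           zero_locus (vanishing_polys g n (\<lambda>i. X i \<omega>)) = UNIV"
proof -
  interpret prob_space M by fact
  \<comment> \<open>\<open>X\<close> is prescribed on \<open>space M\<close> only; \<open>Y\<close> is given by the same formula everywhere, which makes
    its independence and its law immediate.\<close>
  define Y where "Y i \<omega> = \<theta> i + \<epsilon> i \<omega>" for i \<omega>
  have "indep_vars (\<lambda>_. borel) Y {1..}"
    unfolding Y_def by (rule indep_vars_compose2[OF assms(3)]) simp
  moreover have "absolutely_continuous lborel (distr M borel (Y i))" if "i \<ge> 1" for i
    unfolding Y_def by (rule absolutely_continuous_distr_translate[OF assms(4)[OF that]])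
  ultimately have "AE \<omega> in M. \<exists>N\<ge>1. \<forall>n\<ge>N. vanishing_polys g n (\<lambda>i. Y i \<omega>) = {0}" for g
    by (rule AE_vanishing_polys_trivial[OF assms(1)])
  then have "AE \<omega> in M. \<forall>g. \<exists>N\<ge>1. \<forall>n\<ge>N. vanishing_polys g n (\<lambda>i. Y i \<omega>) = {0}"
    by (simp add: AE_all_countable)
  then show ?thesis
  proof (rule AE_mp, intro AE_I2 impI allI)
    fix \<omega> g
    assume \<omega>: "\<omega> \<in> space M"
      and "\<forall>g. \<exists>N\<ge>1. \<forall>n\<ge>N. vanishing_polys g n (\<lambda>i. Y i \<omega>) = {0}"
    then obtain N where "N \<ge> 1" "\<And>n. n \<ge> N \<Longrightarrow> vanishing_polys g n (\<lambda>i. Y i \<omega>) = {0}"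
      by blast
    moreover have "vanishing_polys g n (\<lambda>i. X i \<omega>) = vanishing_polys g n (\<lambda>i. Y i \<omega>)" for n
      using assms(5) \<omega> by (simp add: vanishing_polys_def Y_def)
    ultimately show "\<exists>N\<ge>1. \<forall>n\<ge>N. ideal_generated (vanishing_polys g n (\<lambda>i. X i \<omega>)) = {0} \<and>
        zero_locus (vanishing_polys g n (\<lambda>i. X i \<omega>)) = UNIV"
      by (metis ideal_generated_zero zero_locus_zero)
  qed
qed

end
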